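(* For all $k,n\ge0$, the $k$-twist congruence $\equiv^k$ is a lattice congruence of the (right) weak order on $\mathfrak S_n$.
   Context: The $k$-twist congruence $\equiv^k$ on $\mathfrak S_n$ (permutations as words in one-line notation) is the transitive closure of the rewriting rule $U\,a\,c\,V_1\,b_1\,V_2\,b_2\cdots V_k\,b_k\,W\equiv^k U\,c\,a\,V_1\,b_1\,V_2\,b_2\cdots V_k\,b_k\,W$ whenever $a<b_i<c$ for all $i\in[k]$, where $a,b_1,\dots,b_k,c\in[n]$ and $U,V_1,\dots,V_k,W$ are (possibly empty) words on $[n]$. The weak order on $\mathfrak S_n$: $\tau\le\tau'$ iff every coinversion of $\tau$ (pair $i<j$ with $\tau^{-1}(i)>\tau^{-1}(j)$) is a coinversion of $\tau'$; it is a lattice. An equivalence relation $\equiv$ on a lattice $L$ is a lattice congruence if every equivalence class is an interval of $L$ and the maps sending each element to the minimum (resp. maximum) of its class are order preserving; equivalently, $x\equiv x'$ and $y\equiv y'$ imply $x\wedge y\equiv x'\wedge y'$ and $x\vee y\equiv x'\vee y'$. *)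

theory Defs
  imports "HOL-Algebra.Lattice" "HOL-Combinatorics.Multiset_Permutations"
begin

abbreviation perm_words :: "nat \<Rightarrow> nat list set" where
  "perm_words n \<equiv> permutations_of_set {1..n}"

text \<open>\<open>word_inv \<tau> v\<close> is \<open>\<tau>\<^sup>-\<^sup>1(v)\<close>, with positions counted from 0; the shift
  does not affect comparisons of positions.\<close>

definition word_inv :: "nat list \<Rightarrow> nat \<Rightarrow> nat" where
  "word_inv \<tau> = inv_into {..<length \<tau>} ((!) \<tau>)"

definition coinversions :: "nat list \<Rightarrow> (nat \<times> nat) set" where
  "coinversions \<tau> = {(i, j). i \<in> set \<tau> \<and> j \<in> set \<tau> \<and> i < j \<and> word_inv \<tau> i > word_inv \<tau> j}"

definition weak_order :: "nat \<Rightarrow> nat list gorder" where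
  "weak_order n =
    \<lparr>carrier = perm_words n, eq = (=), le = (\<lambda>\<sigma> \<tau>. coinversions \<sigma> \<subseteq> coinversions \<tau>)\<rparr>"

text \<open>The factor \<open>V\<^sub>1 b\<^sub>1 V\<^sub>2 b\<^sub>2 \<dots> V\<^sub>k b\<^sub>k\<close> is given by the list \<open>Vs\<close> of words
  and the list \<open>bs\<close> of letters. That all letters lie in \<open>{1..n}\<close> follows from
  the two words being permutations.\<close>

inductive_set twist_rule :: "nat \<Rightarrow> nat \<Rightarrow> (nat list \<times> nat list) set"
  for k n :: nat where
  "\<lbrakk>length Vs = k; length bs = k; \<forall>b\<in>set bs. a < b \<and> b < c;
    X = concat (map2 (\<lambda>V b. V @ [b]) Vs bs);
    U @ [a, c] @ X @ W \<in> perm_words n; U @ [c, a] @ X @ W \<in> perm_words n\<rbrakk>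
   \<Longrightarrow> (U @ [a, c] @ X @ W, U @ [c, a] @ X @ W) \<in> twist_rule k n"

text \<open>Since the rule is written with the symmetric sign \<open>\<equiv>\<close>, its closure is taken to be
  the generated equivalence relation on permutations.\<close>

definition twist_congruence :: "nat \<Rightarrow> nat \<Rightarrow> (nat list \<times> nat list) set" where
  "twist_congruence k n = Restr ((twist_rule k n \<union> (twist_rule k n)\<inverse>)\<^sup>*) (perm_words n)"

definition class_min :: "('a, 'b) gorder_scheme \<Rightarrow> ('a \<times> 'a) set \<Rightarrow> 'a \<Rightarrow> 'a" where
  "class_min L R x = (THE m. least L m (R `` {x}))"

definition class_max :: "('a, 'b) gorder_scheme \<Rightarrow> ('a \<times> 'a) set \<Rightarrow> 'a \<Rightarrow> 'a" where
  "class_max L R x = (THE m. greatest L m (R `` {x}))"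

definition lattice_congruence :: "('a, 'b) gorder_scheme \<Rightarrow> ('a \<times> 'a) set \<Rightarrow> bool" where
  "lattice_congruence L R \<longleftrightarrow>
    lattice L \<and> equiv (carrier L) R \<and>
    (\<forall>C \<in> carrier L // R. \<exists>l \<in> carrier L. \<exists>u \<in> carrier L. C = \<lbrace>l..u\<rbrace>\<^bsub>L\<^esub>) \<and>
    isotone L L (class_min L R) \<and> isotone L L (class_max L R)"

end

theory Submission
  imports Defs
begin

text \<open>
  Call a cover \<open>U a c W \<rightarrow> U c a W\<close> of the weak order contracted if at least \<open>k\<close> letters strictly
  between \<open>a\<close> and \<open>c\<close> occur in \<open>W\<close>; these covers generate the congruence. Two distinct covers of a
  word span a square or a hexagon whose top is their join. Opposite sides of such a polygon
  are contracted together, and in a hexagon a contracted side at the bottom or the top contracts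
  the two sides in the middle as well. Hence, if \<open>z \<rightarrow> x\<close> is contracted and \<open>z \<rightarrow> y\<close> is any
  other cover, then contracted covers lead from \<open>y\<close> to \<open>x \<squnion> y\<close>. By induction from the top, maximal
  chains of contracted covers from a word end in a unique normal form, which depends monotonically
  on the word: this is the maximum of its class. The polygons also yield the
  existence of joins. Reversing the order of the alphabet preserves contracted covers and reverses
  the weak order, which gives meets and class minima.
\<close>

section \<open>Contractible steps in polygonal posets\<close>

text \<open>By \<open>step_towards\<close> and finiteness, chains of steps generate
  \<open>le\<close>. The axiom \<open>polygon\<close> is purely local: two steps from
  \<open>z\<close> have a join, and if one of them is contracted, so is a whole chain from the end
  of the other to that join.\<close>

locale polygonal_poset =
  fixes P :: "'a set" and le :: "'a \<Rightarrow> 'a \<Rightarrow> bool"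
    and step contr :: "'a \<Rightarrow> 'a \<Rightarrow> bool"
  assumes fin: "finite P"
    and le_refl: "x \<in> P \<Longrightarrow> le x x"
    and le_trans: "le x y \<Longrightarrow> le y z \<Longrightarrow> le x z"
    and le_antisym: "x \<in> P \<Longrightarrow> y \<in> P \<Longrightarrow> le x y \<Longrightarrow> le y x \<Longrightarrow> x = y"
    and step_closed: "step x y \<Longrightarrow> x \<in> P \<and> y \<in> P"
    and step_less: "step x y \<Longrightarrow> le x y \<and> x \<noteq> y"
    and step_towards: "x \<in> P \<Longrightarrow> y \<in> P \<Longrightarrow> le x y \<Longrightarrow> x \<noteq> y \<Longrightarrow> \<exists>z. step x z \<and> le z y"
    and contr_step: "contr x y \<Longrightarrow> step x y"
    and polygon: "step z x \<Longrightarrow> step z y \<Longrightarrow> x \<noteq> y \<Longrightarrow>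
      \<exists>w\<in>P. le x w \<and> le y w \<and> (\<forall>t\<in>P. le x t \<longrightarrow> le y t \<longrightarrow> le w t) \<and>
        (contr z x \<longrightarrow> contr\<^sup>*\<^sup>* y w) \<and> (contr z y \<longrightarrow> contr\<^sup>*\<^sup>* x w)"
begin

text \<open>The finite set of elements above \<open>x\<close> shrinks strictly along every
  step.\<close>

lemma up_induct [consumes 1, case_names step]:
  assumes "x \<in> P"
    and "\<And>x. x \<in> P \<Longrightarrow> (\<And>y. step x y \<Longrightarrow> Q y) \<Longrightarrow> Q x"
  shows "Q x"
  using assms(1)
proof (induction "card {y\<in>P. le x y}" arbitrary: x rule: less_induct)
  case less
  show ?case
  proof (rule assms(2)[OF less.prems])
    fix y assume s: "step x y"
    have "{z\<in>P. le y z} \<subset> {z\<in>P. le x z}"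
      using s step_less[OF s] step_closed[OF s] le_trans le_refl le_antisym by blast
    then have "card {z\<in>P. le y z} < card {z\<in>P. le x z}"
      using fin by (intro psubset_card_mono) auto
    then show "Q y"
      using less.hyps step_closed[OF s] by blast
  qed
qed

lemma contr_rtranclp_le:
  assumes "contr\<^sup>*\<^sup>* x y" "x \<in> P"
  shows "le x y \<and> y \<in> P"
  using assms
  by (induction rule: rtranclp_induct)
    (use le_refl le_trans contr_step step_less step_closed in blast)+

text \<open>Local joins yield global ones: take one step from the lower bound \<open>z\<close>
  towards each element, join the two steps by \<open>polygon\<close>, and combine by
  induction.\<close>

lemma join_exists:
  assumes "z \<in> P" "x \<in> P" "y \<in> P" "le z x" "le z y"
  shows "\<exists>w\<in>P. le x w \<and> le y w \<and> (\<forall>t\<in>P. le x t \<longrightarrow> le y t \<longrightarrow> le w t)"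
  using assms
proof (induction z arbitrary: x y rule: up_induct)
  case (step z)
  consider "z = x" | "z = y" | "z \<noteq> x" "z \<noteq> y" by blast
  then show ?case
  proof cases
    case 1
    then show ?thesis using step le_refl by blast
  next
    case 2
    then show ?thesis using step le_refl by blast
  next
    case 3
    obtain x' where x': "step z x'" "le x' x"
      using step_towards[of z x] step 3 by blast
    obtain y' where y': "step z y'" "le y' y"
      using step_towards[of z y] step 3 by blast
    show ?thesis
    proof (cases "x' = y'")
      case True
      then show ?thesis using step.IH[OF x'(1), of x y] step.prems x' y' by blast
    next
      case False
      obtain w where w: "w \<in> P" "le x' w" "le y' w"
        "\<forall>t\<in>P. le x' t \<longrightarrow> le y' t \<longrightarrow> le w t"
        using polygon[OF x'(1) y'(1) False] by blast
      \<comment> \<open>The induction hypothesis needs a common lower bound one step higher: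
        \<open>x'\<close> lies below \<open>x\<close> and \<open>w\<close>, and then
        \<open>y'\<close> lies below \<open>u\<close> and \<open>y\<close>.\<close>
      obtain u where u: "u \<in> P" "le x u" "le w u"
        "\<forall>t\<in>P. le x t \<longrightarrow> le w t \<longrightarrow> le u t"
        using step.IH[OF x'(1) step.prems(1) w(1) x'(2) w(2)] by blast
      obtain v where v: "v \<in> P" "le u v" "le y v"
        "\<forall>t\<in>P. le u t \<longrightarrow> le y t \<longrightarrow> le v t"
        using step.IH[OF y'(1) u(1) step.prems(2) _ y'(2)] le_trans[OF w(3) u(3)] by blast
      have "le v t" if "t \<in> P" "le x t" "le y t" for t
        using that u(4) v(4) w(4) le_trans[OF x'(2)] le_trans[OF y'(2)] by blast
      then show ?thesis using v le_trans[OF u(2)] by blast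
    qed
  qed
qed

section \<open>Normal forms under contracted steps\<close>

definition normal :: "'a \<Rightarrow> 'a \<Rightarrow> bool" where
  "normal x m \<longleftrightarrow> contr\<^sup>*\<^sup>* x m \<and> (\<forall>y. \<not> contr m y)"

lemma normal_exists:
  assumes "x \<in> P"
  shows "\<exists>m. normal x m"
  using assms
proof (induction x rule: up_induct)
  case (step x)
  show ?case
  proof (cases "\<exists>y. contr x y")
    case True
    then obtain y m where "contr x y" "normal y m"
      using step contr_step by blast
    then show ?thesis
      unfolding normal_def by (meson converse_rtranclp_into_rtranclp)
  qed (auto simp: normal_def)
qed

text \<open>Confluence and monotonicity come from one induction: the case \<open>z = x\<close>
  contains the uniqueness of normal forms, so until then \<open>normal\<close> has to be a
  relation.\<close>

lemma normal_mono:
  assumes "z \<in> P" "x \<in> P" "le z x" "normal z m" "normal x m'"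
  shows "le m m'"
  using assms
proof (induction z arbitrary: x m m' rule: up_induct)
  case (step z)
  show ?case
  proof (cases "z = m")
    case True
    then show ?thesis
      using step.prems contr_rtranclp_le le_trans unfolding normal_def by blast
  next
    case False
    then obtain z' where z': "contr z z'" "contr\<^sup>*\<^sup>* z' m"
      using step.prems(3) unfolding normal_def by (auto elim: converse_rtranclpE)
    have n: "normal z' m" using z' step.prems(3) unfolding normal_def by blast
    \<comment> \<open>If \<open>z = x\<close>, then \<open>y\<close> begins the contracted chain to
      \<open>m'\<close>; otherwise it is a step towards \<open>x\<close>.\<close>
    obtain y where y: "step z y" "\<exists>x'\<in>P. le y x' \<and> normal x' m'"
    proof (cases "z = x")
      case True
      then obtain y where "contr z y" "contr\<^sup>*\<^sup>* y m'"
        using step.prems(4) z'(1) unfolding normal_def by (metis converse_rtranclpE)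
      then show ?thesis
        using that step.prems(4) contr_step step_closed le_refl unfolding normal_def by blast
    next
      case False
      then show ?thesis
        using that step_towards[of z x] step by blast
    qed
    show ?thesis
    proof (cases "y = z'")
      case True
      then show ?thesis using step.IH[OF y(1)] y(2) n by blast
    next
      case False
      obtain w where w: "w \<in> P" "le z' w" "contr\<^sup>*\<^sup>* y w"
        using polygon[OF contr_step[OF z'(1)] y(1)] False z'(1) by blast
      \<comment> \<open>The normal form \<open>q\<close> of the polygon's top mediates between
        \<open>m\<close> and \<open>m'\<close>: it is above \<open>m\<close> by induction at
        \<open>z'\<close>, and as a normal form of \<open>y\<close> too it is below
        \<open>m'\<close> by induction at \<open>y\<close>.\<close>
      obtain q where q: "normal w q" using normal_exists w(1) by blast
      have "le m q"
        using step.IH[OF contr_step[OF z'(1)] w(1,2) n q] .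
      moreover have "normal y q"
        using q w(3) unfolding normal_def by (meson rtranclp_trans)
      then have "le q m'"
        using step.IH[OF y(1)] y(2) by blast
      ultimately show ?thesis by (rule le_trans)
    qed
  qed
qed

lemma normal_closed: "normal x m \<Longrightarrow> x \<in> P \<Longrightarrow> m \<in> P \<and> le x m"
  using contr_rtranclp_le unfolding normal_def by blast

lemma normal_unique: "x \<in> P \<Longrightarrow> normal x m \<Longrightarrow> normal x m' \<Longrightarrow> m = m'"
  using normal_mono le_refl le_antisym normal_closed by meson

text \<open>A normal form of \<open>y\<close> is also one of \<open>x\<close>; existence at
  \<open>y\<close> and uniqueness at \<open>x\<close> give the converse.\<close>

lemma normal_contr_iff:
  assumes "contr x y"
  shows "normal x m \<longleftrightarrow> normal y m"
proof -
  have P: "x \<in> P" "y \<in> P" using assms contr_step step_closed by blast+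
  have *: "normal x m'" if "normal y m'" for m'
    using that assms unfolding normal_def by (meson converse_rtranclp_into_rtranclp)
  then show ?thesis using normal_unique[OF P(1)] normal_exists[OF P(2)] by metis
qed

lemma normal_cong:
  assumes "(\<lambda>x y. contr x y \<or> contr y x)\<^sup>*\<^sup>* x y"
  shows "normal x m \<longleftrightarrow> normal y m"
  using assms by (induction rule: rtranclp_induct) (auto simp: normal_contr_iff)

end

section \<open>Words and their inversions\<close>

fun before :: "'a list \<Rightarrow> ('a \<times> 'a) set" where
  "before [] = {}"
| "before (x # xs) = {x} \<times> set xs \<union> before xs"

lemma before_append: "before (xs @ ys) = before xs \<union> before ys \<union> set xs \<times> set ys"
  by (induction xs) auto

lemma before_subset: "before xs \<subseteq> set xs \<times> set xs"
  by (induction xs) auto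

lemma before_total:
  "x \<in> set xs \<Longrightarrow> y \<in> set xs \<Longrightarrow> x \<noteq> y \<Longrightarrow> (x, y) \<in> before xs \<or> (y, x) \<in> before xs"
  by (induction xs) auto

lemma before_asym: "distinct xs \<Longrightarrow> (x, y) \<in> before xs \<Longrightarrow> (y, x) \<notin> before xs"
  using before_subset by (induction xs) fastforce+

lemma before_irrefl: "distinct xs \<Longrightarrow> (x, x) \<notin> before xs"
  using before_asym by fast

lemma before_trans:
  "distinct xs \<Longrightarrow> (x, y) \<in> before xs \<Longrightarrow> (y, z) \<in> before xs \<Longrightarrow> (x, z) \<in> before xs"
  using before_subset by (induction xs) fastforce+

lemma before_nth:
  "distinct xs \<Longrightarrow> i < length xs \<Longrightarrow> j < length xs \<Longrightarrow> (xs ! i, xs ! j) \<in> before xs \<longleftrightarrow> i < j"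
proof (induction xs arbitrary: i j)
  case (Cons x xs)
  have "(y, x) \<notin> before xs" for y
    using Cons.prems(1) before_subset by fastforce
  then show ?case
    using Cons by (cases i; cases j) (auto simp: nth_eq_iff_index_eq)
qed simp

text \<open>One inclusion suffices because both relations are total orders of the same letters. In
  the induction, a letter ahead of \<open>x\<close> in \<open>ys\<close> would contradict that
  \<open>x\<close> heads the first word.\<close>

lemma before_inject:
  assumes "distinct xs" "distinct ys" "set xs = set ys" "before xs \<subseteq> before ys"
  shows "xs = ys"
  using assms
proof (induction xs arbitrary: ys)
  case (Cons x xs)
  then obtain us vs where ys: "ys = us @ x # vs"
    by (metis list.set_intros(1) split_list)
  have "us = []"
  proof (rule ccontr)
    assume "us \<noteq> []"
    then obtain u where u: "u \<in> set us" by (meson list.set_sel(1))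
    then have "u \<in> set xs" using Cons.prems ys by auto
    then have "(x, u) \<in> before ys" using Cons.prems(4) by auto
    moreover have "(u, x) \<in> before ys" using u ys by (auto simp: before_append)
    ultimately show False using Cons.prems(2) before_asym by metis
  qed
  moreover have "xs = vs"
  proof (rule Cons.IH)
    have [simp]: "us = []" by fact
    show "distinct xs" "distinct vs" "set xs = set vs" using Cons.prems ys by auto
    show "before xs \<subseteq> before vs"
      using Cons.prems ys before_subset[of xs] by auto
  qed
  ultimately show ?case using ys by simp
qed simp

text \<open>By transitivity, the order of a word is generated by its adjacent pairs.\<close>

lemma before_subset_adjacent:
  assumes "distinct ys"
    and "\<And>U x y W. xs = U @ x # y # W \<Longrightarrow> (x, y) \<in> before ys"
  shows "before xs \<subseteq> before ys"
  using assms(2)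
proof (induction xs rule: induct_list012)
  case (3 x y zs)
  have IH: "before (y # zs) \<subseteq> before ys"
  proof (rule "3.IH"(2))
    fix U v w W assume "y # zs = U @ v # w # W"
    then show "(v, w) \<in> before ys" using "3.prems"[of "x # U"] by simp
  qed
  have xy: "(x, y) \<in> before ys" using "3.prems"[of "[]"] by simp
  show ?case using IH xy before_trans[OF assms(1) xy] by auto
qed auto

text \<open>The parameter \<open>lt\<close> makes it possible to reverse the alphabet;
  \<open><\<close> gives the coinversions of the weak order.\<close>

definition inversions :: "('a \<Rightarrow> 'a \<Rightarrow> bool) \<Rightarrow> 'a list \<Rightarrow> ('a \<times> 'a) set" where
  "inversions lt xs = {(i, j). lt i j \<and> (j, i) \<in> before xs}"

lemma coinversions_eq_inversions:
  assumes "distinct xs"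
  shows "coinversions xs = inversions (<) xs"
proof -
  have bij: "inj_on ((!) xs) {..<length xs}" "(!) xs ` {..<length xs} = set xs"
    using assms by (auto simp: inj_on_nth set_conv_nth)
  have *: "word_inv xs y < length xs \<and> xs ! word_inv xs y = y" if "y \<in> set xs" for y
    using that bij(2) unfolding word_inv_def
    by (metis inv_into_into f_inv_into_f lessThan_iff)
  have "word_inv xs j < word_inv xs i \<longleftrightarrow> (j, i) \<in> before xs"
    if "i \<in> set xs" "j \<in> set xs" for i j
    using before_nth[OF assms, of "word_inv xs j" "word_inv xs i"] *[OF that(1)] *[OF that(2)]
    by simp
  then show ?thesis
    using before_subset[of xs] unfolding coinversions_def inversions_def by blast
qed

lemma inversions_swap:
  assumes "distinct (U @ x # y # W)" "lt x y" "\<not> lt y x"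
  shows "inversions lt (U @ y # x # W) = insert (x, y) (inversions lt (U @ x # y # W))"
  using assms unfolding inversions_def by (auto simp: before_append)

section \<open>The weak order for either orientation of the alphabet\<close>

text \<open>Instantiated at \<open><\<close> for joins and class maxima, and at \<open>>\<close> for
  meets and class minima.\<close>

locale word_order =
  fixes A :: "'a set" and lt :: "'a \<Rightarrow> 'a \<Rightarrow> bool" and k :: nat
  assumes finA: "finite A"
    and lt_trans: "lt x y \<Longrightarrow> lt y z \<Longrightarrow> lt x z"
    and lt_irrefl: "\<not> lt x x"
    and lt_total: "x \<noteq> y \<Longrightarrow> lt x y \<or> lt y x"
begin

abbreviation "words \<equiv> permutations_of_set A"

definition word_le :: "'a list \<Rightarrow> 'a list \<Rightarrow> bool" where
  "word_le xs ys \<longleftrightarrow> inversions lt xs \<subseteq> inversions lt ys"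

text \<open>A count replaces the factorisation of the rewriting rule;
  \<open>interleaving_iff\<close> supplies the link.\<close>

definition heavy :: "'a \<Rightarrow> 'a \<Rightarrow> 'a list \<Rightarrow> bool" where
  "heavy x y W \<longleftrightarrow> k \<le> card {b \<in> set W. lt x b \<and> lt b y}"

inductive swap :: "'a list \<Rightarrow> 'a list \<Rightarrow> bool" where
  "U @ x # y # W \<in> words \<Longrightarrow> lt x y \<Longrightarrow> swap (U @ x # y # W) (U @ y # x # W)"

inductive twist :: "'a list \<Rightarrow> 'a list \<Rightarrow> bool" where
  "U @ x # y # W \<in> words \<Longrightarrow> lt x y \<Longrightarrow> heavy x y W \<Longrightarrow>
    twist (U @ x # y # W) (U @ y # x # W)"

lemma heavy_mono:
  assumes "heavy x y W" "\<And>b. b \<in> set W \<Longrightarrow> lt x b \<Longrightarrow> lt b y \<Longrightarrow> b \<in> set W' \<and> lt x' b \<and> lt b y'"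
  shows "heavy x' y' W'"
proof -
  have "card {b \<in> set W. lt x b \<and> lt b y} \<le> card {b \<in> set W'. lt x' b \<and> lt b y'}"
    using assms(2) by (intro card_mono) auto
  then show ?thesis using assms(1) unfolding heavy_def by linarith
qed

lemma lt_asym: "lt x y \<Longrightarrow> \<not> lt y x"
  using lt_trans lt_irrefl by blast

lemma inversions_swap_insert:
  assumes "U @ x # y # W \<in> words" "lt x y"
  shows "inversions lt (U @ y # x # W) = insert (x, y) (inversions lt (U @ x # y # W))"
  using assms lt_asym by (intro inversions_swap) (auto simp: permutations_of_set_def)

lemma inversions_inject:
  assumes "xs \<in> words" "ys \<in> words" "inversions lt xs = inversions lt ys"
  shows "xs = ys"
proof (rule before_inject)
  show d: "distinct xs" "distinct ys" and s: "set xs = set ys"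
    using assms by (auto simp: permutations_of_set_def)
  show "before xs \<subseteq> before ys"
  proof clarify
    fix i j assume ij: "(i, j) \<in> before xs"
    then have n: "i \<noteq> j" "i \<in> set ys" "j \<in> set ys" "(j, i) \<notin> before xs"
      using before_irrefl[OF d(1)] before_subset[of xs] s before_asym[OF d(1)] by auto
    then show "(i, j) \<in> before ys"
      using ij assms(3) lt_total[OF n(1)] before_total[OF n(2,3,1)]
      unfolding inversions_def by blast
  qed
qed

lemma swap_le: "swap xs ys \<Longrightarrow> word_le xs ys \<and> xs \<noteq> ys"
  by (auto elim!: swap.cases simp: word_le_def inversions_swap_insert lt_irrefl)

lemma swap_closed: "swap xs ys \<Longrightarrow> xs \<in> words \<and> ys \<in> words"
  by (auto elim!: swap.cases simp: permutations_of_set_def)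

text \<open>Some adjacent pair of \<open>xs\<close> is ordered the other way in \<open>ys\<close>.
  It must be an ascent, since a descent would be an inversion of \<open>xs\<close> missing from
  \<open>ys\<close>; swapping it adds only an inversion of \<open>ys\<close>.\<close>

lemma swap_towards:
  assumes "xs \<in> words" "ys \<in> words" "word_le xs ys" "xs \<noteq> ys"
  shows "\<exists>zs. swap xs zs \<and> word_le zs ys"
proof -
  have d: "distinct xs" "distinct ys" "set xs = set ys"
    using assms by (auto simp: permutations_of_set_def)
  have "\<not> before xs \<subseteq> before ys"
    using before_inject d assms(4) by blast
  then obtain U x y W where xs: "xs = U @ x # y # W" and n: "(x, y) \<notin> before ys"
    using before_subset_adjacent[OF d(2)] by metis
  have xy: "(x, y) \<in> before xs" "x \<noteq> y" "x \<in> set ys" "y \<in> set ys"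
    using xs d by (auto simp: before_append simp flip: d(3))
  have yx: "(y, x) \<in> before ys"
    using before_total[OF xy(3,4,2)] n by blast
  have "lt x y"
    using xy(1,2) lt_total[of x y] n assms(3) unfolding word_le_def inversions_def by blast
  then have "swap xs (U @ y # x # W)" "word_le (U @ y # x # W) ys"
    using xs assms(1,3) yx inversions_swap_insert[of U x y W]
    by (auto intro: swap.intros simp: word_le_def inversions_def)
  then show ?thesis by blast
qed

section \<open>Squares and hexagons spanned by two swaps\<close>

definition completes :: "'a list \<Rightarrow> 'a list \<Rightarrow> 'a list \<Rightarrow> 'a list \<Rightarrow> bool" where
  "completes z x y w \<longleftrightarrow> w \<in> words \<and> word_le x w \<and> word_le y w \<and>
    (\<forall>t\<in>words. word_le x t \<longrightarrow> word_le y t \<longrightarrow> word_le w t) \<and>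
    (twist z x \<longrightarrow> twist\<^sup>*\<^sup>* y w) \<and> (twist z y \<longrightarrow> twist\<^sup>*\<^sup>* x w)"

text \<open>The predicate \<open>twist\<close> hides the place of the swap, but the two words
  determine it: it starts at the first position where they differ.\<close>

lemma twist_heavy:
  assumes "twist (U @ x # y # W) (U @ y # x # W)" "distinct (U @ x # y # W)"
  shows "heavy x y W"
  using assms(1)
proof cases
  case (1 U' x' y' W')
  have "length U = length U'"
  proof (rule linorder_cases[of "length U" "length U'"])
    assume l: "length U < length U'"
    have "(U @ x # y # W) ! length U = (U' @ x' # y' # W') ! length U"
         "(U @ y # x # W) ! length U = (U' @ y' # x' # W') ! length U"
      using 1 by simp_all
    then show ?thesis using l assms(2) by (simp add: nth_append)
  next
    assume l: "length U' < length U"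
    have "(U @ x # y # W) ! length U' = (U' @ x' # y' # W') ! length U'"
         "(U @ y # x # W) ! length U' = (U' @ y' # x' # W') ! length U'"
      using 1 by simp_all
    then have "x' = y'" using l by (simp add: nth_append)
    then show ?thesis using 1 lt_irrefl by simp
  qed
  then show ?thesis using 1 by simp
qed

text \<open>Disjoint swaps commute, and neither changes the set of letters to the right of the other
  pair, on which \<open>heavy\<close> depends.\<close>

lemma square:
  assumes z: "U @ x # y # V @ x' # y' # W \<in> words" and lt: "lt x y" "lt x' y'"
  shows "completes (U @ x # y # V @ x' # y' # W) (U @ y # x # V @ x' # y' # W)
    (U @ x # y # V @ y' # x' # W) (U @ y # x # V @ y' # x' # W)"
proof -
  let ?z = "U @ x # y # V @ x' # y' # W"
  have P: "U @ y # x # V @ x' # y' # W \<in> words" "U @ x # y # V @ y' # x' # W \<in> words"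
    "U @ y # x # V @ y' # x' # W \<in> words"
    using z by (auto simp: permutations_of_set_def)
  have d: "distinct ?z" using z by (auto simp: permutations_of_set_def)
  have i1: "inversions lt (U @ y # x # V @ x' # y' # W) = insert (x, y) (inversions lt ?z)"
    using inversions_swap_insert[of U x y] z lt by simp
  have i2: "inversions lt (U @ x # y # V @ y' # x' # W) = insert (x', y') (inversions lt ?z)"
    using inversions_swap_insert[of "U @ x # y # V" x' y'] z lt by simp
  have i3: "inversions lt (U @ y # x # V @ y' # x' # W)
      = insert (x, y) (insert (x', y') (inversions lt ?z))"
    using inversions_swap_insert[of U x y "V @ y' # x' # W"] P lt i2 by simp
  have "twist (U @ x # y # V @ y' # x' # W) (U @ y # x # V @ y' # x' # W)"
    if "twist ?z (U @ y # x # V @ x' # y' # W)"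
    using twist_heavy[OF that] d P lt by (intro twist.intros) (auto elim!: heavy_mono)
  moreover have "twist (U @ y # x # V @ x' # y' # W) (U @ y # x # V @ y' # x' # W)"
    if "twist ?z (U @ x # y # V @ y' # x' # W)"
    using twist_heavy[of "U @ x # y # V" x' y' W] that d P lt
      twist.intros[of "U @ y # x # V" x' y' W] by auto
  ultimately show ?thesis
    using P i1 i2 i3 unfolding completes_def word_le_def by auto
qed

text \<open>Both chains to the top swap the pair \<open>a\<close>, \<open>c\<close> and the pair
  swapped first by the other chain. Letters between \<open>a\<close> and \<open>b\<close>, or
  between \<open>b\<close> and \<open>c\<close>, also lie between \<open>a\<close> and
  \<open>c\<close>, so a contracted bottom side contracts the rest of the opposite chain.\<close>

lemma hexagon:
  assumes z: "U @ a # b # c # W \<in> words" and lt: "lt a b" "lt b c"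
  shows "completes (U @ a # b # c # W) (U @ b # a # c # W) (U @ a # c # b # W) (U @ c # b # a # W)"
proof -
  let ?z = "U @ a # b # c # W"
  have P: "U @ b # a # c # W \<in> words" "U @ a # c # b # W \<in> words" "U @ b # c # a # W \<in> words"
    "U @ c # a # b # W \<in> words" "U @ c # b # a # W \<in> words"
    using z by (auto simp: permutations_of_set_def)
  have d: "distinct ?z" using z by (auto simp: permutations_of_set_def)
  have ac: "lt a c" using lt_trans lt by blast
  have i1: "inversions lt (U @ b # a # c # W) = insert (a, b) (inversions lt ?z)"
    using inversions_swap_insert[of U a b] z lt by simp
  have i2: "inversions lt (U @ a # c # b # W) = insert (b, c) (inversions lt ?z)"
    using inversions_swap_insert[of "U @ [a]" b c] z lt by simp
  have i3: "inversions lt (U @ b # c # a # W) = insert (a, c) (insert (a, b) (inversions lt ?z))"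
    using inversions_swap_insert[of "U @ [b]" a c] P ac i1 by simp
  have i4: "inversions lt (U @ c # b # a # W)
      = insert (b, c) (insert (a, c) (insert (a, b) (inversions lt ?z)))"
    using inversions_swap_insert[of U b c] P lt i3 by simp
  have "twist\<^sup>*\<^sup>* (U @ a # c # b # W) (U @ c # b # a # W)"
    if "twist ?z (U @ b # a # c # W)"
  proof -
    \<comment> \<open>The tail is \<open>c # W\<close>, but \<open>c\<close> lies beyond
      \<open>b\<close> and is not counted.\<close>
    have h: "heavy a b W"
      using twist_heavy[OF that d] by (rule heavy_mono) (use lt_asym lt in auto)
    have "twist (U @ a # c # b # W) (U @ c # a # b # W)"
      using P ac h by (intro twist.intros) (auto elim!: heavy_mono intro: lt_trans[OF _ lt(2)])
    moreover have "twist (U @ c # a # b # W) (U @ c # b # a # W)"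
      using twist.intros[of "U @ [c]" a b W] P lt h by simp
    ultimately show ?thesis by (meson converse_rtranclp_into_rtranclp r_into_rtranclp)
  qed
  moreover have "twist\<^sup>*\<^sup>* (U @ b # a # c # W) (U @ c # b # a # W)"
    if "twist ?z (U @ a # c # b # W)"
  proof -
    have h: "heavy b c W"
      using twist_heavy[of "U @ [a]" b c W] that d by simp
    have "heavy a c W" using h by (rule heavy_mono) (use lt_trans[OF lt(1)] in auto)
    then have "twist (U @ b # a # c # W) (U @ b # c # a # W)"
      using twist.intros[of "U @ [b]" a c W] P ac by simp
    moreover have "twist (U @ b # c # a # W) (U @ c # b # a # W)"
      using P lt h by (intro twist.intros) (auto elim!: heavy_mono)
    ultimately show ?thesis by (meson converse_rtranclp_into_rtranclp r_into_rtranclp)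
  qed
  moreover have "word_le (U @ c # b # a # W) t"
    if "t \<in> words" "word_le (U @ b # a # c # W) t" "word_le (U @ a # c # b # W) t" for t
  proof -
    have "distinct t" using that by (auto simp: permutations_of_set_def)
    moreover have "(b, a) \<in> before t" "(c, b) \<in> before t"
      using that(2,3) i1 i2 unfolding word_le_def inversions_def by auto
    \<comment> \<open>Transitivity forces the inversion of \<open>a\<close> and \<open>c\<close>, so
      the top is the least upper bound.\<close>
    ultimately have "(c, a) \<in> before t" by (meson before_trans)
    then show ?thesis
      using that(2,3) ac i1 i2 i4 unfolding word_le_def inversions_def by auto
  qed
  ultimately show ?thesis
    using P i1 i2 i4 unfolding completes_def word_le_def by auto
qed

lemma completes_sym: "completes z x y w \<Longrightarrow> completes z y x w"
  unfolding completes_def by blast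

text \<open>Distinct swaps of one word happen at distinct positions; by symmetry one may be taken to
  be further left.\<close>

lemma swaps_complete:
  assumes "swap z s" "swap z t" "s \<noteq> t"
  shows "\<exists>w. completes z s t w"
proof -
  have main: "\<exists>w. completes z (U @ y # x # W) (U' @ y' # x' # W') w"
    if z: "z = U @ x # y # W" "z = U' @ x' # y' # W'" "z \<in> words" and lt: "lt x y" "lt x' y'"
      and l: "length U < length U'" for U x y W U' x' y' W'
  proof -
    \<comment> \<open>\<open>T\<close> leads from the start of the left swap to the start of the
      right one. If it has length one, the swaps share the letter \<open>y\<close> and span a
      hexagon; otherwise they are disjoint.\<close>
    obtain T where T: "U' = U @ T" "T @ x' # y' # W' = x # y # W" "T \<noteq> []"
      using z(1,2) l by (auto simp: append_eq_append_conv2)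
    show ?thesis
    proof (cases "tl T")
      case Nil
      then have "T = [x]" "x' = y" "W = y' # W'" using T(2,3) by (cases T; auto)+
      then show ?thesis using hexagon[of U x y y' W'] z lt T by auto
    next
      case (Cons v V)
      then have "T = x # y # V" "W = V @ x' # y' # W'" using T(2,3) by (cases T; auto)+
      then show ?thesis using square[of U x y V x' y' W'] z lt T by auto
    qed
  qed
  obtain U x y W where 1: "z = U @ x # y # W" "s = U @ y # x # W" "z \<in> words" "lt x y"
    using assms(1) by (auto elim: swap.cases)
  obtain U' x' y' W' where 2: "z = U' @ x' # y' # W'" "t = U' @ y' # x' # W'" "lt x' y'"
    using assms(2) by (auto elim: swap.cases)
  consider "length U < length U'" | "length U' < length U" | "length U = length U'" by linarith
  then show ?thesis
  proof cases
    case 1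
    then show ?thesis using main \<open>z = U @ x # y # W\<close> \<open>s = _\<close> \<open>z \<in> words\<close> \<open>lt x y\<close> 2 by blast
  next
    case 2
    then show ?thesis
      using main[of U' x' y' W' U x y W] 1 \<open>z = U' @ x' # y' # W'\<close> \<open>t = _\<close> \<open>lt x' y'\<close> completes_sym by blast
  next
    case 3
    then show ?thesis using 1 2 assms(3) by auto
  qed
qed

sublocale polygonal_poset words word_le swap twist
proof
  show "finite words" using finA by simp
  show "word_le x x" for x by (simp add: word_le_def)
  show "word_le x y \<Longrightarrow> word_le y z \<Longrightarrow> word_le x z" for x y z by (auto simp: word_le_def)
  show "x \<in> words \<Longrightarrow> y \<in> words \<Longrightarrow> word_le x y \<Longrightarrow> word_le y x \<Longrightarrow> x = y" for x y
    using inversions_inject unfolding word_le_def by blast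
  show "\<exists>w\<in>words. word_le x w \<and> word_le y w \<and>
      (\<forall>t\<in>words. word_le x t \<longrightarrow> word_le y t \<longrightarrow> word_le w t) \<and>
      (twist z x \<longrightarrow> twist\<^sup>*\<^sup>* y w) \<and> (twist z y \<longrightarrow> twist\<^sup>*\<^sup>* x w)"
    if "swap z x" "swap z y" "x \<noteq> y" for x y z
    using swaps_complete[OF that] unfolding completes_def by blast
  show "twist x y \<Longrightarrow> swap x y" for x y by (auto elim!: twist.cases intro: swap.intros)
qed (use swap_le swap_closed swap_towards in auto)

text \<open>A sorted word has no inversions, so it provides the common lower bound that
  \<open>join_exists\<close> asks for.\<close>

lemma sorted_word_le:
  assumes "sorted_wrt lt xs"
  shows "word_le xs ys"
proof -
  have "lt i j" if "(i, j) \<in> before xs" for i j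
    using assms that by (induction xs) auto
  then show ?thesis using lt_asym unfolding word_le_def inversions_def by blast
qed

end

section \<open>The twist congruence\<close>

declare One_nat_def [simp del] \<comment> \<open>keeps the alphabet \<open>{1..n}\<close> in the form of the definitions\<close>

text \<open>The factorisation can be read off greedily from the first \<open>k\<close> letters
  satisfying \<open>Q\<close>; the remaining ones stay in \<open>W'\<close>.\<close>

lemma interleaving_iff:
  "(\<exists>Vs bs W'. length Vs = k \<and> length bs = k \<and> (\<forall>b\<in>set bs. Q b) \<and>
      W = concat (map2 (\<lambda>V b. V @ [b]) Vs bs) @ W') \<longleftrightarrow> k \<le> length (filter Q W)"
proof
  have "length Vs \<le> length (filter Q (concat (map2 (\<lambda>V b. V @ [b]) Vs bs)))"
    if "length Vs = length bs" "\<forall>b\<in>set bs. Q b" for Vs bs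
    using that by (induction Vs bs rule: list_induct2) auto
  then show "k \<le> length (filter Q W)"
    if "\<exists>Vs bs W'. length Vs = k \<and> length bs = k \<and> (\<forall>b\<in>set bs. Q b) \<and>
      W = concat (map2 (\<lambda>V b. V @ [b]) Vs bs) @ W'"
    using that by (force intro: trans_le_add1)
next
  assume "k \<le> length (filter Q W)"
  then show "\<exists>Vs bs W'. length Vs = k \<and> length bs = k \<and> (\<forall>b\<in>set bs. Q b) \<and>
      W = concat (map2 (\<lambda>V b. V @ [b]) Vs bs) @ W'"
  proof (induction k arbitrary: W)
    case (Suc k)
    then obtain b bs where "filter Q W = b # bs"
      by (cases "filter Q W") auto
    \<comment> \<open>\<open>V\<close> is the prefix before the first letter that satisfies
      \<open>Q\<close>.\<close>
    then obtain V W1 where W: "W = V @ b # W1" "Q b" "filter Q W1 = bs"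
      unfolding filter_eq_Cons_iff by blast
    then have "k \<le> length (filter Q W1)"
      using Suc.prems \<open>filter Q W = b # bs\<close> by simp
    then obtain Vs bs W' where "length Vs = k" "length bs = k" "\<forall>b\<in>set bs. Q b"
      "W1 = concat (map2 (\<lambda>V b. V @ [b]) Vs bs) @ W'"
      using Suc.IH by blast
    then have "length (V # Vs) = Suc k \<and> length (b # bs) = Suc k \<and> (\<forall>b\<in>set (b # bs). Q b) \<and>
      W = concat (map2 (\<lambda>V b. V @ [b]) (V # Vs) (b # bs)) @ W'"
      using W by simp
    then show ?case by blast
  qed simp
qed

lemma word_order_less: "word_order {1..n} ((<) :: nat \<Rightarrow> nat \<Rightarrow> bool)"
  by unfold_locales auto

lemma word_order_greater: "word_order {1..n} ((>) :: nat \<Rightarrow> nat \<Rightarrow> bool)"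
  by unfold_locales auto

text \<open>Only the symmetrised relations are compared, because for \<open>k = 0\<close> the rule
  also contains descending swaps, which \<open>twist\<close> excludes.\<close>

lemma twist_rule_symmetric_iff:
  "(s, t) \<in> twist_rule k n \<union> (twist_rule k n)\<inverse> \<longleftrightarrow>
    word_order.twist {1..n} (<) k s t \<or> word_order.twist {1..n} (<) k t s"
proof -
  interpret word_order "{1..n}" "(<) :: nat \<Rightarrow> nat \<Rightarrow> bool" k by (rule word_order_less)
  have heavy_iff: "heavy a c W \<longleftrightarrow> (\<exists>Vs bs W'. length Vs = k \<and> length bs = k \<and>
      (\<forall>b\<in>set bs. a < b \<and> b < c) \<and> W = concat (map2 (\<lambda>V b. V @ [b]) Vs bs) @ W')"
    if "distinct W" for a c W
    unfolding interleaving_iff heavy_def using distinct_card[of "filter (\<lambda>b. a < b \<and> b < c) W"] that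
    by simp
  have 1: "twist s t \<or> twist t s" if "(s, t) \<in> twist_rule k n" for s t
    using that
  proof cases
    case (1 Vs bs a c X U W)
    then have P: "U @ a # c # X @ W \<in> words" "U @ c # a # X @ W \<in> words" by simp_all
    then have "a \<noteq> c" by (auto simp: permutations_of_set_def)
    have "heavy a c (X @ W)"
      using 1 P by (subst heavy_iff) (auto simp: permutations_of_set_def)
    show ?thesis
    proof (cases "a < c")
      case True
      then show ?thesis
        using 1 P \<open>heavy a c (X @ W)\<close> twist.intros[of U a c "X @ W"] by simp
    next
      case False
      \<comment> \<open>For \<open>k = 0\<close> the rule puts no constraint on \<open>a\<close> and \<open>c\<close>, so it may also be oriented downwards.\<close>
      then have "bs = []" using 1 by (cases bs) auto
      then have "heavy c a (X @ W)" using 1(3,4) by (simp only: heavy_def) simp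
      then show ?thesis
        using 1 P False \<open>a \<noteq> c\<close> twist.intros[of U c a "X @ W"] by simp
    qed
  qed
  have 2: "(s, t) \<in> twist_rule k n" if "twist s t" for s t
    using that
  proof cases
    case (1 U a c W)
    then have "distinct W" by (auto simp: permutations_of_set_def)
    then obtain Vs bs W' where *: "length Vs = k" "length bs = k" "\<forall>b\<in>set bs. a < b \<and> b < c"
      "W = concat (map2 (\<lambda>V b. V @ [b]) Vs bs) @ W'"
      using 1 heavy_iff by blast
    have "U @ [c, a] @ W \<in> words" using 1(3) by (auto simp: permutations_of_set_def)
    then show ?thesis
      using twist_rule.intros[OF *(1-3) refl, of U W' n] 1 * by simp
  qed
  show ?thesis using 1 2 by blast
qed

text \<open>Reversing the alphabet reverses the direction of each swap but keeps the set of letters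
  between the two swapped ones.\<close>

lemma twist_greater_iff:
  "word_order.twist {1..n} (>) k s t \<longleftrightarrow> word_order.twist {1..n} ((<) :: nat \<Rightarrow> nat \<Rightarrow> bool) k t s"
proof -
  interpret up: word_order "{1..n}" "(<) :: nat \<Rightarrow> nat \<Rightarrow> bool" k by (rule word_order_less)
  interpret down: word_order "{1..n}" "(>) :: nat \<Rightarrow> nat \<Rightarrow> bool" k by (rule word_order_greater)
  have h: "down.heavy y x W \<longleftrightarrow> up.heavy x y W" for x y W
    unfolding up.heavy_def down.heavy_def by (simp add: conj_commute)
  have P: "U @ y # x # W \<in> perm_words n \<longleftrightarrow> U @ x # y # W \<in> perm_words n" for U x y W
    by (auto simp: permutations_of_set_def)
  show ?thesis
    unfolding up.twist.simps down.twist.simps h using P by metis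
qed

section \<open>The weak order as a lattice\<close>

lemma weak_order_le_iff_less:
  assumes "s \<in> perm_words n" "t \<in> perm_words n"
  shows "s \<sqsubseteq>\<^bsub>weak_order n\<^esub> t \<longleftrightarrow> word_order.word_le (<) s t"
  using assms
  by (simp add: weak_order_def word_order.word_le_def[OF word_order_less]
      coinversions_eq_inversions permutations_of_set_def)

text \<open>Up to transposition, inversions for \<open>>\<close> are the complement of inversions
  for \<open><\<close> among the pairs \<open>i < j\<close>, and complementation reverses
  inclusion.\<close>

lemma weak_order_le_iff_greater:
  assumes "s \<in> perm_words n" "t \<in> perm_words n"
  shows "s \<sqsubseteq>\<^bsub>weak_order n\<^esub> t \<longleftrightarrow> word_order.word_le (>) t s"
proof -
  have "inversions (>) xs = {(j, i). i \<in> {1..n} \<and> j \<in> {1..n} \<and> i < j \<and> (i, j) \<notin> inversions (<) xs}"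
    if "xs \<in> perm_words n" for xs
  proof -
    have xs: "distinct xs" "set xs = {1..n}" using that by (auto simp: permutations_of_set_def)
    have "(i, j) \<in> before xs \<longleftrightarrow> i \<in> {1..n} \<and> j \<in> {1..n} \<and> (j, i) \<notin> before xs" if "i < j" for i j
      using before_asym[OF xs(1), of i j] before_total[of i xs j] before_subset[of xs]
        less_imp_neq[OF that]
      unfolding xs(2) by blast
    then show ?thesis
      unfolding inversions_def by blast
  qed
  moreover have "inversions (<) xs \<subseteq> {1..n} \<times> {1..n} \<inter> {(i, j). i < j}"
    if "xs \<in> perm_words n" for xs
    using that before_subset[of xs] unfolding inversions_def by (auto simp: permutations_of_set_def)
  ultimately show ?thesis
    using assms unfolding weak_order_le_iff_less[OF assms]
      word_order.word_le_def[OF word_order_less] word_order.word_le_def[OF word_order_greater]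
    by blast
qed

lemma carrier_weak_order [simp]: "carrier (weak_order n) = perm_words n"
  by (simp add: weak_order_def)

lemma eq_weak_order [simp]: "(.=\<^bsub>weak_order n\<^esub>) = (=)"
  by (simp add: weak_order_def)

lemma partial_order_weak_order: "partial_order (weak_order n)"
proof -
  \<comment> \<open>\<open>word_le\<close> is the same for every \<open>k\<close>, so 0 is an
    arbitrary choice.\<close>
  interpret up: word_order "{1..n}" "(<) :: nat \<Rightarrow> nat \<Rightarrow> bool" 0 by (rule word_order_less)
  show ?thesis
    by unfold_locales
      (auto simp: weak_order_le_iff_less up.le_refl intro: up.le_antisym up.le_trans)
qed

lemma lattice_weak_order: "lattice (weak_order n)"
proof -
  interpret partial_order "weak_order n" by (rule partial_order_weak_order)
  interpret up: word_order "{1..n}" "(<) :: nat \<Rightarrow> nat \<Rightarrow> bool" 0 by (rule word_order_less)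
  interpret down: word_order "{1..n}" "(>) :: nat \<Rightarrow> nat \<Rightarrow> bool" 0 by (rule word_order_greater)
  \<comment> \<open>The identity is the bottom for \<open><\<close> and its reversal the bottom for
    \<open>>\<close>; joins for \<open>>\<close> are the meets of the weak order.\<close>
  define e where "e = [1..<Suc n]"
  have e: "e \<in> perm_words n" "rev e \<in> perm_words n"
    unfolding e_def by (auto simp: permutations_of_set_def)
  have bot: "up.word_le e s" "down.word_le (rev e) s" for s
    unfolding e_def by (auto intro!: up.sorted_word_le down.sorted_word_le
      simp: sorted_wrt_rev simp del: upt_Suc)
  show ?thesis
  proof
    fix s t assume st: "s \<in> carrier (weak_order n)" "t \<in> carrier (weak_order n)"
    then obtain w where w: "w \<in> perm_words n" "up.word_le s w" "up.word_le t w"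
      "\<forall>u\<in>perm_words n. up.word_le s u \<longrightarrow> up.word_le t u \<longrightarrow> up.word_le w u"
      using up.join_exists[OF e(1) _ _ bot(1) bot(1), of s t] unfolding carrier_weak_order by blast
    then have "least (weak_order n) w (Upper (weak_order n) {s, t})"
      using st by (auto simp: least_def Upper_def weak_order_le_iff_less)
    then show "\<exists>w. least (weak_order n) w (Upper (weak_order n) {s, t})" ..
    obtain v where v: "v \<in> perm_words n" "down.word_le s v" "down.word_le t v"
      "\<forall>u\<in>perm_words n. down.word_le s u \<longrightarrow> down.word_le t u \<longrightarrow> down.word_le v u"
      using st down.join_exists[OF e(2) _ _ bot(2) bot(2), of s t] unfolding carrier_weak_order by blast
    then have "greatest (weak_order n) v (Lower (weak_order n) {s, t})"
      using st by (auto simp: greatest_def Lower_def weak_order_le_iff_greater)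
    then show "\<exists>v. greatest (weak_order n) v (Lower (weak_order n) {s, t})" ..
  qed
qed

theorem theorem37:
  fixes k n :: nat
  shows "lattice_congruence (weak_order n) (twist_congruence k n)"
proof -
  interpret L: partial_order "weak_order n" by (rule partial_order_weak_order)
  interpret up: word_order "{1..n}" "(<) :: nat \<Rightarrow> nat \<Rightarrow> bool" k by (rule word_order_less)
  interpret down: word_order "{1..n}" "(>) :: nat \<Rightarrow> nat \<Rightarrow> bool" k by (rule word_order_greater)
  let ?P = "perm_words n" and ?R = "twist_congruence k n" and ?L = "weak_order n"
  have R_iff: "(s, t) \<in> ?R \<longleftrightarrow> s \<in> ?P \<and> t \<in> ?P \<and> (\<lambda>s t. up.twist s t \<or> up.twist t s)\<^sup>*\<^sup>* s t" for s t
  proof -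
    have "{(s, t). up.twist s t \<or> up.twist t s} = twist_rule k n \<union> (twist_rule k n)\<inverse>"
      unfolding twist_rule_symmetric_iff[symmetric] by blast
    then show ?thesis
      unfolding twist_congruence_def rtranclp_rtrancl_eq by auto
  qed
  have equiv: "equiv ?P ?R"
  proof (rule equivI)
    show "sym ?R"
      unfolding twist_congruence_def
      by (intro symI) (auto intro: symD[OF sym_rtrancl[OF sym_Un_converse]])
    show "trans ?R"
      by (intro transI) (auto simp: R_iff)
  qed (auto simp: refl_on_def R_iff)
  have normal_up_iff: "up.normal s m \<longleftrightarrow> up.normal t m" if "(s, t) \<in> ?R" for s t m
    using that up.normal_cong by (simp add: R_iff)
  \<comment> \<open>Both orientations have the same symmetrised twists, hence the same
    classes.\<close>
  have normal_down_iff: "down.normal s m \<longleftrightarrow> down.normal t m" if "(s, t) \<in> ?R" for s t m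
    using that down.normal_cong[of s t m] by (simp add: R_iff twist_greater_iff disj_commute)
  have normal_up_R: "(s, m) \<in> ?R" if "s \<in> ?P" "up.normal s m" for s m
  proof -
    have "(\<lambda>s t. up.twist s t \<or> up.twist t s)\<^sup>*\<^sup>* s m"
      using that mono_rtranclp[of up.twist "\<lambda>s t. up.twist s t \<or> up.twist t s"] up.normal_def by blast
    then show ?thesis using that up.normal_closed by (simp add: R_iff)
  qed
  have normal_down_R: "(s, m) \<in> ?R" if "s \<in> ?P" "down.normal s m" for s m
  proof -
    have "(\<lambda>s t. up.twist s t \<or> up.twist t s)\<^sup>*\<^sup>* s m"
      using that mono_rtranclp[of down.twist "\<lambda>s t. up.twist s t \<or> up.twist t s"] down.normal_def
      by (auto simp: twist_greater_iff)
    then show ?thesis using that down.normal_closed by (simp add: R_iff)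
  qed
  \<comment> \<open>All members of the class share the normal form \<open>m\<close>, and each word
    lies below its normal form.\<close>
  have greatest: "greatest ?L m (?R `` {s})" if "s \<in> ?P" "up.normal s m" for s m
    using that normal_up_R[OF that] normal_up_iff[of s] up.normal_closed
    by (auto simp: greatest_def R_iff weak_order_le_iff_less)
  have least: "least ?L m (?R `` {s})" if "s \<in> ?P" "down.normal s m" for s m
    using that normal_down_R[OF that] normal_down_iff[of s] down.normal_closed
    by (auto simp: least_def R_iff weak_order_le_iff_greater)
  have class_max: "class_max ?L ?R s = m" if "s \<in> ?P" "up.normal s m" for s m
    unfolding class_max_def using greatest[OF that] L.greatest_unique by blast
  have class_min: "class_min ?L ?R s = m" if "s \<in> ?P" "down.normal s m" for s m
    unfolding class_min_def using least[OF that] L.least_unique by blast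
  have max_mono: "class_max ?L ?R s \<sqsubseteq>\<^bsub>?L\<^esub> class_max ?L ?R t"
    if st: "s \<in> ?P" "t \<in> ?P" "s \<sqsubseteq>\<^bsub>?L\<^esub> t" for s t
  proof -
    obtain m m' where m: "up.normal s m" "up.normal t m'"
      using up.normal_exists st by blast
    then have "m \<in> ?P" "m' \<in> ?P" using up.normal_closed st by blast+
    then show ?thesis
      using st m up.normal_mono[of s t m m']
      by (simp only: class_max weak_order_le_iff_less)
  qed
  have min_mono: "class_min ?L ?R s \<sqsubseteq>\<^bsub>?L\<^esub> class_min ?L ?R t"
    if st: "s \<in> ?P" "t \<in> ?P" "s \<sqsubseteq>\<^bsub>?L\<^esub> t" for s t
  proof -
    obtain m m' where m: "down.normal s m" "down.normal t m'"
      using down.normal_exists st by blast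
    then have "m \<in> ?P" "m' \<in> ?P" using down.normal_closed st by blast+
    then show ?thesis
      \<comment> \<open>The arguments change places because \<open>>\<close> reverses the weak
        order.\<close>
      using st m down.normal_mono[of t s m' m]
      by (simp only: class_min weak_order_le_iff_greater)
  qed
  have interval: "\<exists>l\<in>?P. \<exists>u\<in>?P. ?R `` {s} = \<lbrace>l..u\<rbrace>\<^bsub>?L\<^esub>" if s: "s \<in> ?P" for s
  proof -
    obtain l u where l: "down.normal s l" and u: "up.normal s u"
      using up.normal_exists[OF s] down.normal_exists[OF s] by blast
    have lu: "(s, l) \<in> ?R" "(s, u) \<in> ?R"
      using normal_down_R[OF s l] normal_up_R[OF s u] .
    then have P: "l \<in> ?P" "u \<in> ?P"
      unfolding R_iff by blast+
    \<comment> \<open>Convexity of the class: \<open>l\<close> and \<open>u\<close> both have class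
      maximum \<open>u\<close>, so monotonicity squeezes the class maximum of \<open>t\<close> to
      \<open>u\<close>.\<close>
    have "(s, t) \<in> ?R" if t: "t \<in> ?P" "l \<sqsubseteq>\<^bsub>?L\<^esub> t" "t \<sqsubseteq>\<^bsub>?L\<^esub> u" for t
    proof -
      obtain m where m: "up.normal t m" using up.normal_exists[OF t(1)] by blast
      have "class_max ?L ?R l = u" "class_max ?L ?R u = u" "class_max ?L ?R t = m"
        using class_max[OF P(1)] class_max[OF P(2)] class_max[OF t(1)] m u
          normal_up_iff[OF lu(1)] normal_up_iff[OF lu(2)] by blast+
      then have "u \<sqsubseteq>\<^bsub>?L\<^esub> m" "m \<sqsubseteq>\<^bsub>?L\<^esub> u"
        using max_mono[OF P(1) t(1,2)] max_mono[OF t(1) P(2) t(3)] by simp_all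
      then have "m = u"
        using L.le_antisym P up.normal_closed[OF m t(1)] unfolding carrier_weak_order by blast
      then show ?thesis
        using normal_up_R[OF t(1) m] lu(2) equiv by (meson equivE symD transD)
    qed
    moreover have "l \<sqsubseteq>\<^bsub>?L\<^esub> t \<and> t \<sqsubseteq>\<^bsub>?L\<^esub> u \<and> t \<in> ?P" if "(s, t) \<in> ?R" for t
      using that greatest[OF s u] least[OF s l] 
      unfolding greatest_def least_def carrier_weak_order by blast
    ultimately have "?R `` {s} = \<lbrace>l..u\<rbrace>\<^bsub>?L\<^esub>"
      unfolding at_least_at_most_def carrier_weak_order by blast
    then show ?thesis using P by blast
  qed
  show ?thesis
    unfolding lattice_congruence_def isotone_def carrier_weak_order
  proof (intro conjI ballI impI)
    fix C assume "C \<in> ?P // ?R"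
    then show "\<exists>l\<in>?P. \<exists>u\<in>?P. C = \<lbrace>l..u\<rbrace>\<^bsub>?L\<^esub>"
      using interval by (elim quotientE) simp
  qed (fact lattice_weak_order equiv max_mono min_mono L.weak_partial_order_axioms)+
qed

end
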